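(* Let $L$ be any normal modal logic with the universal modality such that ${\sf K}_u \subseteq L \subseteq {\sf K4}_u$. Then the admissibility problem for inference rules in $L$ is undecidable: there is no algorithm that decides, given $\mathcal{L}$-formulas $\varphi_1,\dots,\varphi_n,\varphi$, whether for every substitution $\sigma$, $\sigma(\varphi_1)\in L,\dots,\sigma(\varphi_n)\in L$ imply $\sigma(\varphi)\in L$.
   Context: $\mathcal{L}$ is the propositional language with infinitely many propositional variables, Boolean connectives $\wedge,\neg$ (and derived ones, including $\bot,\top$), and unary modal operators $\Box$ and $\forall$, with duals $\Diamond=\neg\Box\neg$, $\exists=\neg\forall\neg$. A normal modal logic with the universal modality is a set of $\mathcal{L}$-formulas containing all propositional tautologies and the axioms $\Box(p\to q)\to(\Box p\to\Box q)$, $\forall(p\to q)\to(\forall p\to\forall q)$, $\forall p\to p$, $\forall p\to\forall\forall p$, $p\to\forall\exists p$, $\forall p\to\Box p$, closed under modus ponens, necessitation for $\Box$ and for $\forall$, and uniform substitution. ${\sf K}_u$ is the smallest such logic (the formulas valid in all frames $(W,R)$, with $\forall$ the universal modality over $W$); ${\sf K4}_u$ is the smallest such logic containing $\Box p\to\Box\Box p$ (the formulas valid in all transitive frames). A substitution maps propositional variables to $\mathcal{L}$-formulas and is extended homomorphically. *)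

theory Defs
  imports Main "HOL-Library.Nat_Bijection"
begin

datatype fm = Var nat | Neg fm | And fm fm | Box fm | Univ fm

definition Imp :: "fm \<Rightarrow> fm \<Rightarrow> fm" where "Imp a b = Neg (And a (Neg b))"
definition Dia :: "fm \<Rightarrow> fm" where "Dia a = Neg (Box (Neg a))"
definition Ex :: "fm \<Rightarrow> fm" where "Ex a = Neg (Univ (Neg a))"

primrec subst :: "(nat \<Rightarrow> fm) \<Rightarrow> fm \<Rightarrow> fm" where
  "subst s (Var n) = s n"
| "subst s (Neg a) = Neg (subst s a)"
| "subst s (And a b) = And (subst s a) (subst s b)"
| "subst s (Box a) = Box (subst s a)"
| "subst s (Univ a) = Univ (subst s a)"

primrec beval :: "(fm \<Rightarrow> bool) \<Rightarrow> fm \<Rightarrow> bool" where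
  "beval v (Var n) = v (Var n)"
| "beval v (Neg a) = (\<not> beval v a)"
| "beval v (And a b) = (beval v a \<and> beval v b)"
| "beval v (Box a) = v (Box a)"
| "beval v (Univ a) = v (Univ a)"

definition taut :: "fm \<Rightarrow> bool" where "taut a = (\<forall>v. beval v a)"

abbreviation "pp \<equiv> Var 0"
abbreviation "qq \<equiv> Var 1"

definition base_axioms :: "fm set" where
  "base_axioms =
    { Imp (Box (Imp pp qq)) (Imp (Box pp) (Box qq)),
      Imp (Univ (Imp pp qq)) (Imp (Univ pp) (Univ qq)),
      Imp (Univ pp) pp,
      Imp (Univ pp) (Univ (Univ pp)),
      Imp pp (Univ (Ex pp)),
      Imp (Univ pp) (Box pp) }"

definition normal_logic_u :: "fm set \<Rightarrow> bool" where
  "normal_logic_u L \<longleftrightarrow>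
     (\<forall>a. taut a \<longrightarrow> a \<in> L) \<and> base_axioms \<subseteq> L \<and>
     (\<forall>a b. a \<in> L \<longrightarrow> Imp a b \<in> L \<longrightarrow> b \<in> L) \<and>
     (\<forall>a. a \<in> L \<longrightarrow> Box a \<in> L) \<and>
     (\<forall>a. a \<in> L \<longrightarrow> Univ a \<in> L) \<and>
     (\<forall>a s. a \<in> L \<longrightarrow> subst s a \<in> L)"

inductive_set gen_logic :: "fm set \<Rightarrow> fm set" for A :: "fm set" where
  taut: "taut a \<Longrightarrow> a \<in> gen_logic A"
| ax: "a \<in> base_axioms \<Longrightarrow> a \<in> gen_logic A"
| extra: "a \<in> A \<Longrightarrow> a \<in> gen_logic A"
| mp: "a \<in> gen_logic A \<Longrightarrow> Imp a b \<in> gen_logic A \<Longrightarrow> b \<in> gen_logic A"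
| nec_box: "a \<in> gen_logic A \<Longrightarrow> Box a \<in> gen_logic A"
| nec_univ: "a \<in> gen_logic A \<Longrightarrow> Univ a \<in> gen_logic A"
| sub: "a \<in> gen_logic A \<Longrightarrow> subst s a \<in> gen_logic A"

definition Ku :: "fm set" where "Ku = gen_logic {}"
definition K4u :: "fm set" where "K4u = gen_logic {Imp (Box pp) (Box (Box pp))}"

definition admissible :: "fm set \<Rightarrow> fm list \<Rightarrow> fm \<Rightarrow> bool" where
  "admissible L phis phi \<longleftrightarrow>
     (\<forall>s. (\<forall>a \<in> set phis. subst s a \<in> L) \<longrightarrow> subst s phi \<in> L)"

datatype recf = Zero | Succ | Proj nat | Comp recf "recf list" | Prec recf recf | Mu recf

inductive recf_eval :: "recf \<Rightarrow> nat list \<Rightarrow> nat \<Rightarrow> bool" where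
  zero: "recf_eval Zero xs 0"
| succ: "recf_eval Succ (x # xs) (Suc x)"
| proj: "i < length xs \<Longrightarrow> recf_eval (Proj i) xs (xs ! i)"
| comp: "length ys = length gs \<Longrightarrow> (\<forall>i < length gs. recf_eval (gs ! i) xs (ys ! i)) \<Longrightarrow>
           recf_eval f ys z \<Longrightarrow> recf_eval (Comp f gs) xs z"
| prec0: "recf_eval f xs y \<Longrightarrow> recf_eval (Prec f g) (0 # xs) y"
| precS: "recf_eval (Prec f g) (n # xs) y \<Longrightarrow> recf_eval g (y # n # xs) z \<Longrightarrow>
           recf_eval (Prec f g) (Suc n # xs) z"
| mu: "recf_eval f (n # xs) 0 \<Longrightarrow> (\<forall>m < n. \<exists>k. recf_eval f (m # xs) (Suc k)) \<Longrightarrow>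
           recf_eval (Mu f) xs n"

definition decides :: "recf \<Rightarrow> ('a \<Rightarrow> nat) \<Rightarrow> ('a \<Rightarrow> bool) \<Rightarrow> bool" where
  "decides f code P \<longleftrightarrow> (\<forall>x. recf_eval f [code x] (if P x then 0 else 1))"

primrec fm_code :: "fm \<Rightarrow> nat" where
  "fm_code (Var n) = prod_encode (0, n)"
| "fm_code (Neg a) = prod_encode (1, fm_code a)"
| "fm_code (And a b) = prod_encode (2, prod_encode (fm_code a, fm_code b))"
| "fm_code (Box a) = prod_encode (3, fm_code a)"
| "fm_code (Univ a) = prod_encode (4, fm_code a)"

definition rule_code :: "fm list \<times> fm \<Rightarrow> nat" where
  "rule_code r = prod_encode (list_encode (map fm_code (fst r)), fm_code (snd r))"

end

(* Evaluation facts "f(xs) = y" of recursive functions are the least model of a Horn program.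
   Such a program G and a query are turned into a formula F = (G -> query), where a fact is the
   existence of a world describing it and the variables of the clauses are propositional variables.
   If the query is derivable, F is unifiable in every normal L: in a model without the query some
   clause instance of the derivation fails, and a substitution can select its values (that the
   instance of F is in L follows from completeness with respect to all models).  If the query is
   not derivable, the transitive frame whose worlds describe the true facts refutes F under every
   valuation, so F is not unifiable even in K4u.  Hence the rule F / false is admissible in L iff
   the query is not derivable.  A decision procedure f for admissibility then yields a function h
   with h(c) = f(code of the rule for the program coded by c and the query "h(c) = 0"); taking c to
   be the code of the program of h itself gives h(c) = 0 iff h(c) is not 0. *)
theory Submission
  imports Defs "HOL-Library.Countable"
begin

section \<open>Kripke semantics\<close>

abbreviation Fls :: fm where "Fls \<equiv> And pp (Neg pp)"
abbreviation Tru :: fm where "Tru \<equiv> Neg Fls"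

primrec sem :: "'w set \<Rightarrow> ('w \<Rightarrow> 'w \<Rightarrow> bool) \<Rightarrow> (nat \<Rightarrow> 'w \<Rightarrow> bool) \<Rightarrow> fm \<Rightarrow> 'w \<Rightarrow> bool" where
  "sem W R V (Var n) w = V n w"
| "sem W R V (Neg a) w = (\<not> sem W R V a w)"
| "sem W R V (And a b) w = (sem W R V a w \<and> sem W R V b w)"
| "sem W R V (Box a) w = (\<forall>u\<in>W. R w u \<longrightarrow> sem W R V a u)"
| "sem W R V (Univ a) w = (\<forall>u\<in>W. sem W R V a u)"

lemma sem_Imp [simp]: "sem W R V (Imp a b) w = (sem W R V a w \<longrightarrow> sem W R V b w)"
  by (simp add: Imp_def)

lemma sem_Dia [simp]: "sem W R V (Dia a) w = (\<exists>u\<in>W. R w u \<and> sem W R V a u)"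
  by (simp add: Dia_def)

lemma sem_Ex [simp]: "sem W R V (Ex a) w = (\<exists>u\<in>W. sem W R V a u)"
  by (simp add: Ex_def)

lemma sem_subst: "sem W R V (subst s a) w = sem W R (\<lambda>n. sem W R V (s n)) a w"
  by (induction a arbitrary: w) auto

lemma sem_taut: assumes "taut a" shows "sem W R V a w"
proof -
  have "beval (\<lambda>b. sem W R V b w) b = sem W R V b w" for b
    by (induction b) auto
  then show ?thesis using assms by (auto simp: taut_def)
qed

text \<open>The induction generalizes the valuation because closure under substitution replaces it
  by the one that the substitution induces.\<close>

lemma K4u_sound:
  assumes "a \<in> K4u" and "\<And>x y z. R x y \<Longrightarrow> R y z \<Longrightarrow> R x z" and "w \<in> W"
  shows "sem W R V a w"
  using assms(1,3) unfolding K4u_def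
proof (induction a arbitrary: V w rule: gen_logic.induct)
  case (taut a)
  then show ?case by (simp add: sem_taut)
next
  case (ax a)
  then show ?case by (auto simp: base_axioms_def)
next
  case (extra a)
  then show ?case using assms(2) by auto
next
  case (sub a s)
  then show ?case by (simp add: sem_subst)
qed auto

section \<open>Canonical models\<close>

lemma beval_Imp [simp]: "beval v (Imp a b) = (beval v a \<longrightarrow> beval v b)"
  by (simp add: Imp_def)

lemma beval_foldr_Imp [simp]:
  "beval v (foldr Imp as a) = ((\<forall>b\<in>set as. beval v b) \<longrightarrow> beval v a)"
  by (induction as) auto

locale normal_logic =
  fixes L :: "fm set"
  assumes normal: "normal_logic_u L"
begin

lemma taut_in: "(\<And>v. beval v a) \<Longrightarrow> a \<in> L"
  using normal by (auto simp: normal_logic_u_def taut_def)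

lemma mp: "Imp a b \<in> L \<Longrightarrow> a \<in> L \<Longrightarrow> b \<in> L"
  using normal unfolding normal_logic_u_def by blast

lemma nec: "a \<in> L \<Longrightarrow> Box a \<in> L" "a \<in> L \<Longrightarrow> Univ a \<in> L"
  using normal unfolding normal_logic_u_def by blast+

lemma axioms:
  "Imp (Box (Imp a b)) (Imp (Box a) (Box b)) \<in> L"
  "Imp (Univ (Imp a b)) (Imp (Univ a) (Univ b)) \<in> L"
  "Imp (Univ a) a \<in> L"
  "Imp (Univ a) (Univ (Univ a)) \<in> L"
  "Imp a (Univ (Ex a)) \<in> L"
  "Imp (Univ a) (Box a) \<in> L"
proof -
  have *: "subst (\<lambda>n. if n = 0 then a else b) c \<in> L" if "c \<in> base_axioms" for c
    using that normal unfolding normal_logic_u_def by blast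
  show "Imp (Box (Imp a b)) (Imp (Box a) (Box b)) \<in> L"
    using *[of "Imp (Box (Imp pp qq)) (Imp (Box pp) (Box qq))"]
    by (simp add: base_axioms_def Imp_def)
  show "Imp (Univ (Imp a b)) (Imp (Univ a) (Univ b)) \<in> L"
    using *[of "Imp (Univ (Imp pp qq)) (Imp (Univ pp) (Univ qq))"]
    by (simp add: base_axioms_def Imp_def)
  show "Imp (Univ a) a \<in> L"
    using *[of "Imp (Univ pp) pp"] by (simp add: base_axioms_def Imp_def)
  show "Imp (Univ a) (Univ (Univ a)) \<in> L"
    using *[of "Imp (Univ pp) (Univ (Univ pp))"] by (simp add: base_axioms_def Imp_def)
  show "Imp a (Univ (Ex a)) \<in> L"
    using *[of "Imp pp (Univ (Ex pp))"] by (simp add: base_axioms_def Imp_def Ex_def)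
  show "Imp (Univ a) (Box a) \<in> L"
    using *[of "Imp (Univ pp) (Box pp)"] by (simp add: base_axioms_def Imp_def)
qed

text \<open>Premises are discharged by nested implications, so finitely many suffice and
  necessitation is only ever applied to members of \<open>L\<close>.\<close>

definition entails :: "fm set \<Rightarrow> fm \<Rightarrow> bool" where
  "entails S a \<longleftrightarrow> (\<exists>as. set as \<subseteq> S \<and> foldr Imp as a \<in> L)"

lemma entails_L: "a \<in> L \<Longrightarrow> entails S a"
  unfolding entails_def by (rule exI[of _ "[]"]) simp

lemma entails_mem: "a \<in> S \<Longrightarrow> entails S a"
  unfolding entails_def by (rule exI[of _ "[a]"]) (simp add: taut_in)

lemma entails_mp:
  assumes "entails S (Imp a b)" "entails S a"
  shows "entails S b"
proof -
  obtain as bs where as: "set as \<subseteq> S" "foldr Imp as (Imp a b) \<in> L"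
    and bs: "set bs \<subseteq> S" "foldr Imp bs a \<in> L"
    using assms unfolding entails_def by blast
  have "Imp (foldr Imp as (Imp a b)) (Imp (foldr Imp bs a) (foldr Imp (as @ bs) b)) \<in> L"
    by (rule taut_in) (auto simp del: foldr_append)
  then have "foldr Imp (as @ bs) b \<in> L"
    using as(2) bs(2) mp by blast
  then show ?thesis
    using as(1) bs(1) unfolding entails_def by (metis Un_least set_append)
qed

lemma entails_taut:
  assumes "entails S a" "\<And>v. beval v a \<Longrightarrow> beval v b"
  shows "entails S b"
proof -
  have "Imp a b \<in> L" by (rule taut_in) (simp add: assms(2))
  then show ?thesis using assms(1) by (rule entails_mp[OF entails_L])
qed

lemma entails_deduct:
  assumes "entails (insert a S) b"
  shows "entails S (Imp a b)"
proof -
  obtain as where as: "set as \<subseteq> insert a S" "foldr Imp as b \<in> L"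
    using assms unfolding entails_def by blast
  let ?bs = "filter (\<lambda>c. c \<noteq> a) as"
  have "Imp (foldr Imp as b) (foldr Imp ?bs (Imp a b)) \<in> L"
    by (rule taut_in) auto
  then have "foldr Imp ?bs (Imp a b) \<in> L"
    using as(2) mp by blast
  moreover have "set ?bs \<subseteq> S" using as(1) by auto
  ultimately show ?thesis unfolding entails_def by blast
qed

section \<open>Maximal consistent sets\<close>

definition mcs :: "fm set \<Rightarrow> bool" where
  "mcs M \<longleftrightarrow> \<not> entails M Fls \<and> (\<forall>a. a \<in> M \<or> Neg a \<in> M)"

text \<open>Zorn's lemma applies because a derivation of \<open>Fls\<close> from the union of a
  chain uses finitely many premises, all in one member of the chain.\<close>

lemma Lindenbaum:
  assumes "\<not> entails S Fls"
  obtains M where "mcs M" "S \<subseteq> M"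
proof -
  let ?A = "{T. S \<subseteq> T \<and> \<not> entails T Fls}"
  have "\<exists>M\<in>?A. \<forall>X\<in>?A. M \<subseteq> X \<longrightarrow> X = M"
  proof (rule subset_Zorn_nonempty)
    show "?A \<noteq> {}" using assms by blast
  next
    fix C assume C: "C \<noteq> {}" "subset.chain ?A C"
    have "\<not> entails (\<Union>C) Fls"
    proof
      assume "entails (\<Union>C) Fls"
      then obtain as where as: "set as \<subseteq> \<Union>C" "foldr Imp as Fls \<in> L"
        unfolding entails_def by blast
      obtain T where "T \<in> C" "set as \<subseteq> T"
        using finite_subset_Union_chain[OF _ as(1) C] by auto
      then have "T \<in> ?A" "entails T Fls"
        using as(2) C(2) by (auto simp: entails_def subset.chain_def)
      then show False by blast
    qed
    moreover obtain T where "T \<in> C" using C(1) by blast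
    moreover from this have "S \<subseteq> T" using C(2) by (simp add: subset.chain_def subset_iff)
    ultimately show "\<Union>C \<in> ?A" by blast
  qed
  then obtain M where M: "M \<in> ?A" "\<forall>X\<in>?A. M \<subseteq> X \<longrightarrow> X = M" by (rule bexE)
  have *: "entails M (Imp a Fls)" if "a \<notin> M" for a
  proof -
    have "entails (insert a M) Fls"
      using M(1) bspec[OF M(2), of "insert a M"] that by blast
    then show ?thesis by (rule entails_deduct)
  qed
  have "a \<in> M \<or> Neg a \<in> M" for a
  proof (rule ccontr)
    assume "\<not> (a \<in> M \<or> Neg a \<in> M)"
    then have "entails M (Imp a Fls)" "entails M (Imp (Neg a) Fls)"
      using * by blast+
    moreover have "entails M (Imp (Imp a Fls) (Imp (Imp (Neg a) Fls) Fls))"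
      by (intro entails_L taut_in) auto
    ultimately have "entails M Fls" by (metis entails_mp)
    then show False using M(1) by blast
  qed
  then have "mcs M" using M(1) by (auto simp: mcs_def)
  then show ?thesis using M(1) that by blast
qed

lemma mcs_Neg: assumes "mcs M" shows "Neg a \<in> M \<longleftrightarrow> a \<notin> M"
proof -
  have "\<not> (a \<in> M \<and> Neg a \<in> M)"
  proof
    assume "a \<in> M \<and> Neg a \<in> M"
    then have "entails M a" "entails M (Neg a)" by (auto intro: entails_mem)
    moreover have "entails M (Imp a (Imp (Neg a) Fls))"
      by (intro entails_L taut_in) auto
    ultimately show False using assms by (metis entails_mp mcs_def)
  qed
  then show ?thesis using assms by (auto simp: mcs_def)
qed

lemma mcs_closed: assumes "mcs M" "entails M a" shows "a \<in> M"
proof (rule ccontr)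
  assume "a \<notin> M"
  then have "entails M (Neg a)" using assms(1) by (auto simp: mcs_Neg intro: entails_mem)
  moreover have "entails M (Imp a (Imp (Neg a) Fls))"
    by (intro entails_L taut_in) auto
  ultimately show False using assms by (metis entails_mp mcs_def)
qed

lemma mcs_mp: "mcs M \<Longrightarrow> Imp a b \<in> L \<Longrightarrow> a \<in> M \<Longrightarrow> b \<in> M"
  by (meson entails_L entails_mem entails_mp mcs_closed)

lemma mcs_And: assumes "mcs M" shows "And a b \<in> M \<longleftrightarrow> a \<in> M \<and> b \<in> M"
proof
  assume "And a b \<in> M"
  then show "a \<in> M \<and> b \<in> M"
    using entails_taut[OF entails_mem] mcs_closed[OF assms] by fastforce
next
  assume ab: "a \<in> M \<and> b \<in> M"
  have "Imp a (Imp b (And a b)) \<in> L" by (rule taut_in) auto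
  then show "And a b \<in> M"
    using ab by (meson assms entails_L entails_mem entails_mp mcs_closed)
qed

text \<open>Here \<open>H\<close> stands for \<open>Box\<close> or \<open>Univ\<close>.
  Necessitation and distribution lift a derivation of \<open>a\<close> from
  \<open>{b. H b \<in> M}\<close> to one of \<open>H a\<close> from \<open>M\<close>.\<close>

lemma mcs_successor:
  assumes M: "mcs M" and H: "\<And>a. a \<in> L \<Longrightarrow> H a \<in> L"
    and K: "\<And>a b. Imp (H (Imp a b)) (Imp (H a) (H b)) \<in> L" and "H a \<notin> M"
  obtains M' where "mcs M'" "a \<notin> M'" "{b. H b \<in> M} \<subseteq> M'"
proof -
  let ?S = "{b. H b \<in> M}"
  have dist: "entails M (H b)" if "set as \<subseteq> ?S" "entails M (H (foldr Imp as b))" for as b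
    using that
  proof (induction as)
    case (Cons c as)
    have "entails M (H c)" using Cons.prems(1) by (auto intro: entails_mem)
    then have "entails M (H (foldr Imp as b))"
      using Cons.prems(2) entails_mp[OF entails_mp[OF entails_L[OF K]]] by simp
    then show ?case using Cons by auto
  qed simp
  have "\<not> entails (insert (Neg a) ?S) Fls"
  proof
    assume "entails (insert (Neg a) ?S) Fls"
    then have "entails ?S (Imp (Neg a) Fls)" by (rule entails_deduct)
    then have "entails ?S a" by (rule entails_taut) auto
    then obtain as where as: "set as \<subseteq> ?S" "foldr Imp as a \<in> L"
      unfolding entails_def by blast
    have "entails M (H a)" by (rule dist[OF as(1) entails_L[OF H[OF as(2)]]])
    then show False using mcs_closed M assms(4) by blast
  qed
  then obtain M' where M': "mcs M'" "insert (Neg a) ?S \<subseteq> M'" by (rule Lindenbaum)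
  then have "a \<notin> M'" using mcs_Neg by blast
  then show ?thesis using M' that by blast
qed

theorem completeness:
  assumes valid: "\<And>W R V w. w \<in> W \<Longrightarrow> sem (W :: fm set set) R V a w"
  shows "a \<in> L"
proof (rule ccontr)
  assume "a \<notin> L"
  have "\<not> entails {Neg a} Fls"
  proof
    assume "entails {Neg a} Fls"
    then have "entails {} (Imp (Neg a) Fls)" by (rule entails_deduct)
    then have "entails {} a" by (rule entails_taut) auto
    then show False using \<open>a \<notin> L\<close> by (simp add: entails_def)
  qed
  then obtain G where G: "mcs G" "{Neg a} \<subseteq> G" by (rule Lindenbaum)
  \<comment> \<open>Restricting the canonical model to these sets makes \<open>Univ\<close> quantify
    over all worlds: by \<open>up\<close> and \<open>down\<close> they agree with \<open>G\<close>
    on every formula \<open>Univ b\<close>.\<close>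
  define W where "W = {M. mcs M \<and> {b. Univ b \<in> G} \<subseteq> M}"
  define R where "R M M' \<longleftrightarrow> {b. Box b \<in> M} \<subseteq> M'" for M M' :: "fm set"
  define V where "V n M \<longleftrightarrow> Var n \<in> M" for n and M :: "fm set"
  have up: "Univ b \<in> M" if "Univ b \<in> G" "M \<in> W" for b M
    using that mcs_mp[OF G(1) axioms(4)] by (auto simp: W_def)
  have down: "Univ b \<in> G" if "Univ b \<in> M" "M \<in> W" for b M
  proof (rule ccontr)
    have M: "mcs M" using that by (simp add: W_def)
    assume "Univ b \<notin> G"
    then have "Neg (Univ b) \<in> G" using G(1) by (simp add: mcs_Neg)
    then have "Ex (Neg (Univ b)) \<in> M"
      using mcs_mp[OF G(1) axioms(5)] that(2) by (auto simp: W_def)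
    then have "Univ (Neg (Neg (Univ b))) \<notin> M"
      using M by (simp add: Ex_def mcs_Neg)
    moreover have "Univ (Univ b) \<in> M" using mcs_mp[OF M axioms(4)] that(1) .
    moreover have "Imp (Univ (Univ b)) (Univ (Neg (Neg (Univ b)))) \<in> L"
      by (rule mp[OF axioms(2)], rule nec(2), rule taut_in) auto
    ultimately show False using mcs_mp[OF M] by blast
  qed
  have truth: "sem W R V b M \<longleftrightarrow> b \<in> M" if "M \<in> W" for b M
    using that
  proof (induction b arbitrary: M)
    case (Box b)
    then have M: "mcs M" by (simp add: W_def)
    show ?case
    proof
      assume *: "sem W R V (Box b) M"
      show "Box b \<in> M"
      proof (rule ccontr)
        assume "Box b \<notin> M"
        then obtain M' where M': "mcs M'" "b \<notin> M'" "{c. Box c \<in> M} \<subseteq> M'"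
          using mcs_successor[OF M nec(1) axioms(1)] by blast
        \<comment> \<open>The axiom \<open>Imp (Univ b) (Box b)\<close> keeps successors among the
          worlds.\<close>
        have "M' \<in> W"
          using M' up[OF _ Box.prems] mcs_mp[OF M axioms(6)] by (auto simp: W_def)
        moreover have "R M M'" using M' by (simp add: R_def)
        ultimately show False using * Box.IH M' by simp
      qed
    next
      assume "Box b \<in> M"
      then have "b \<in> u" if "R M u" for u using that by (auto simp: R_def)
      then show "sem W R V (Box b) M" using Box.IH by simp
    qed
  next
    case (Univ b)
    then have M: "mcs M" by (simp add: W_def)
    show ?case
    proof
      assume *: "sem W R V (Univ b) M"
      show "Univ b \<in> M"
      proof (rule ccontr)
        assume "Univ b \<notin> M"
        then obtain M' where M': "mcs M'" "b \<notin> M'" "{c. Univ c \<in> M} \<subseteq> M'"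
          using mcs_successor[OF M nec(2) axioms(2)] by blast
        have "M' \<in> W"
          using M' up[OF _ Univ.prems] by (auto simp: W_def)
        then show False using * Univ.IH M' by auto
      qed
    next
      assume "Univ b \<in> M"
      then have "Univ b \<in> G" using down Univ.prems by blast
      then show "sem W R V (Univ b) M" using Univ.IH by (auto simp: W_def)
    qed
  qed (auto simp: V_def W_def mcs_Neg mcs_And)
  have "G \<in> W" using G(1) mcs_mp[OF G(1) axioms(3)] by (auto simp: W_def)
  then have "a \<in> G" using truth valid by blast
  then show False using G mcs_Neg by blast
qed

end

section \<open>Horn programs over the natural numbers\<close>

datatype tm = Ze | Va nat | Su tm

primrec gnd :: "(nat \<Rightarrow> nat) \<Rightarrow> tm \<Rightarrow> nat" where
  "gnd s Ze = 0"
| "gnd s (Va x) = s x"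
| "gnd s (Su t) = Suc (gnd s t)"

primrec tvars :: "tm \<Rightarrow> nat set" where
  "tvars Ze = {}"
| "tvars (Va x) = {x}"
| "tvars (Su t) = tvars t"

abbreviation avars :: "tm list \<Rightarrow> nat set" where
  "avars ts \<equiv> (\<Union>t\<in>set ts. tvars t)"

type_synonym clause = "tm list list \<times> tm list"

inductive derivable :: "clause list \<Rightarrow> nat list \<Rightarrow> bool" for G where
  rule: "(ps, c) \<in> set G \<Longrightarrow> (\<And>p. p \<in> set ps \<Longrightarrow> derivable G (map (gnd s) p)) \<Longrightarrow>
    derivable G (map (gnd s) c)"

definition closed_under :: "clause list \<Rightarrow> nat list set \<Rightarrow> bool" where
  "closed_under G D \<longleftrightarrow> (\<forall>(ps, c)\<in>set G. \<forall>s.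
     (\<forall>p\<in>set ps. map (gnd s) p \<in> D) \<longrightarrow> map (gnd s) c \<in> D)"

text \<open>Under an arbitrary valuation the formula standing for a variable may denote nothing; safety
  guarantees that some premise is then false.\<close>

definition safe :: "clause list \<Rightarrow> bool" where
  "safe G \<longleftrightarrow> (\<forall>(ps, c)\<in>set G. c \<noteq> [] \<and> [] \<notin> set ps \<and> avars c \<subseteq> (\<Union>p\<in>set ps. avars p))"

section \<open>Modal encoding of Horn programs\<close>

text \<open>The intended frame is the one built from \<open>pt\<close> below: \<open>rho\<close> holds at its reflexive point,
  \<open>numeric\<close> at the points \<open>NN (Suc n)\<close>, \<open>num n\<close> at \<open>NN (Suc n)\<close> only, \<open>pos j\<close> at \<open>BB j\<close> only,
  and \<open>tips 0 as\<close> at the facts whose arguments are exactly the numbers denoted by \<open>as\<close>.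
  As \<open>numeric\<close> points form a chain, \<open>pick x\<close> turns an arbitrary valuation of the variable \<open>x\<close>
  into at most one number.\<close>

definition imm :: "fm \<Rightarrow> fm" where "imm a = And (Dia a) (Neg (Dia (Dia a)))"
definition rho :: fm where "rho = And (Dia Tru) (Box (Dia Tru))"
text \<open>On the chain \<open>imm\<close> acts as successor. The points \<open>TT j n\<close> also
  satisfy \<open>imm (num n)\<close>; they see \<open>rho\<close>, so the second conjunct removes
  them.\<close>

definition nxt :: "fm \<Rightarrow> fm" where "nxt a = And (imm a) (Neg (Dia rho))"
definition numeric :: fm where "numeric = And (Dia Tru) (Neg (Dia rho))"
definition branch :: fm where "branch = And (Dia rho) (Dia (Box Fls))"

primrec num :: "nat \<Rightarrow> fm" where
  "num 0 = nxt Tru"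
| "num (Suc n) = nxt (num n)"

definition pick :: "nat \<Rightarrow> fm" where
  "pick x = And (And (Var x) numeric) (Neg (Dia (And (Var x) numeric)))"

primrec trm :: "tm \<Rightarrow> fm" where
  "trm Ze = num 0"
| "trm (Va x) = pick x"
| "trm (Su t) = nxt (trm t)"

text \<open>\<open>BB 0\<close> is the only \<open>branch\<close> point that sees no
  \<open>branch\<close> point. Besides \<open>BB (Suc j)\<close> also every \<open>TT j n\<close>
  satisfies \<open>imm (pos j)\<close>; it sees \<open>num 0\<close> and is thereby removed.\<close>

primrec pos :: "nat \<Rightarrow> fm" where
  "pos 0 = And branch (Neg (Dia branch))"
| "pos (Suc j) = And (imm (pos j)) (Neg (Dia (num 0)))"

text \<open>Conversely, of the points with \<open>imm (pos j)\<close>, the conjuncts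
  \<open>Dia (num 0)\<close> and \<open>imm a\<close> leave only points \<open>TT j n\<close>. The
  base case says that the argument list stops before position \<open>j\<close>.\<close>

primrec tips :: "nat \<Rightarrow> fm list \<Rightarrow> fm" where
  "tips j [] = Neg (Dia (And (imm (pos j)) (Dia (num 0))))"
| "tips j (a # as) = And (Dia (And (imm (pos j)) (imm a))) (tips (Suc j) as)"

definition holds :: "fm list \<Rightarrow> fm" where "holds as = Ex (tips 0 as)"

definition conj :: "fm list \<Rightarrow> fm" where "conj as = foldr And as Tru"

definition clause_fm :: "clause \<Rightarrow> fm" where
  "clause_fm cl = Imp (conj (map (\<lambda>p. holds (map trm p)) (fst cl))) (holds (map trm (snd cl)))"

definition prog_fm :: "clause list \<Rightarrow> fm" where
  "prog_fm G = Univ (conj (map clause_fm G))"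

definition query_fm :: "clause list \<Rightarrow> nat list \<Rightarrow> fm" where
  "query_fm G ns = Imp (prog_fm G) (holds (map num ns))"

lemma sem_conj [simp]: "sem W R V (conj as) w \<longleftrightarrow> (\<forall>a\<in>set as. sem W R V a w)"
  by (induction as) (auto simp: conj_def)

lemma sem_prog_fm:
  "sem W R V (prog_fm G) w \<longleftrightarrow> (\<forall>u\<in>W. \<forall>(ps, c)\<in>set G.
     (\<forall>p\<in>set ps. sem W R V (holds (map trm p)) u) \<longrightarrow> sem W R V (holds (map trm c)) u)"
  by (simp add: prog_fm_def clause_fm_def case_prod_unfold)

section \<open>Derivable queries are unifiable\<close>

text \<open>The only variable in \<open>num n\<close> sits inside \<open>Fls\<close>, whose value is
  constant.\<close>

lemma sem_num_irrelevant: "sem W R V (num n) w = sem W R V' (num n) w"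
  by (induction n arbitrary: w) (simp_all add: nxt_def imm_def rho_def)

lemma sem_pos_irrelevant: "sem W R V (pos n) w = sem W R V' (pos n) w"
  by (induction n arbitrary: w)
    (simp_all add: branch_def imm_def rho_def sem_num_irrelevant[of W R V 0 _ V'] del: num.simps)

lemma sem_tips_cong:
  assumes "list_all2 (\<lambda>a b. \<forall>w\<in>W. sem W R V a w = sem W R V' b w) as bs"
  shows "sem W R V (tips j as) w = sem W R V' (tips j bs) w"
  using assms
proof (induction arbitrary: j rule: list_all2_induct)
  case Nil
  then show ?case
    by (simp add: imm_def sem_pos_irrelevant[of W R V _ _ V'] sem_num_irrelevant[of W R V _ _ V']
        del: num.simps pos.simps)
next
  case (Cons a as b bs)
  have "(\<exists>u\<in>W. R w u \<and> sem W R V (imm (pos j)) u \<and> sem W R V (imm a) u) \<longleftrightarrow>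
    (\<exists>u\<in>W. R w u \<and> sem W R V' (imm (pos j)) u \<and> sem W R V' (imm b) u)"
    using Cons.hyps(1) by (simp add: imm_def sem_pos_irrelevant[of W R V _ _ V'] cong: bex_cong)
  then show ?case using Cons.IH by simp
qed

lemma sem_holds_cong:
  assumes "\<And>t w. t \<in> set ts \<Longrightarrow> w \<in> W \<Longrightarrow> sem W R V (f t) w = sem W R V' (g t) w"
  shows "sem W R V (holds (map f ts)) w = sem W R V' (holds (map g ts)) w'"
proof -
  have "list_all2 (\<lambda>a b. \<forall>w\<in>W. sem W R V a w = sem W R V' b w) (map f ts) (map g ts)"
    using assms by (simp add: list_all2_conv_all_nth)
  from sem_tips_cong[OF this] show ?thesis by (simp add: holds_def)
qed

lemma sem_nxt_irreflexive: "sem W R V (nxt a) w \<Longrightarrow> \<not> sem W R V (Dia (nxt a)) w"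
  by (auto simp: nxt_def imm_def)

lemma sem_nxt_numeric: "sem W R V (nxt a) w \<Longrightarrow> sem W R V numeric w"
  by (auto simp: nxt_def imm_def numeric_def)

text \<open>In every frame, transitive or not, \<open>num n\<close> implies \<open>numeric\<close>
  and no point of \<open>num n\<close> sees another one, so \<open>pick\<close> changes
  nothing.\<close>

lemma sem_pick_num:
  assumes "\<And>w. V x w = sem W R V (num n) w"
  shows "sem W R V (pick x) w = sem W R V (num n) w"
proof -
  obtain a where a: "num n = nxt a" by (cases n) auto
  have *: "sem W R V (And (Var x) numeric) u = sem W R V (nxt a) u" for u
    using assms[of u] sem_nxt_numeric[of W R V a u] unfolding a by auto
  have "sem W R V (Dia (And (Var x) numeric)) w = sem W R V (Dia (nxt a)) w"
    unfolding sem_Dia * ..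
  then show ?thesis
    using * sem_nxt_irreflexive[of W R V a w] unfolding pick_def a sem.simps(2,3) by blast
qed

lemma sem_trm_num:
  assumes "V' = (\<lambda>x. sem W R V (num (s x)))"
  shows "sem W R V' (trm t) w = sem W R V (num (gnd s t)) w"
proof -
  have *: "sem W R V (num n) w = sem W R V' (num n) w" for n w
    by (rule sem_num_irrelevant)
  have "sem W R V' (trm t) w = sem W R V' (num (gnd s t)) w"
  proof (induction t arbitrary: w)
    case (Va x)
    have "V' x w = sem W R V' (num (s x)) w" for w
      using assms *[of "s x" w] by simp
    then show ?case by (simp add: sem_pick_num)
  qed (simp_all add: nxt_def imm_def)
  then show ?thesis using * by simp
qed

text \<open>If the conclusion of the last rule fails in a model, either its premises hold and this
  instance refutes \<open>prog_fm G\<close>, or a premise fails and its own list applies. The finite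
  list \<open>D\<close> is the same for all models.\<close>

lemma derivable_refutations:
  assumes "derivable G ns"
  shows "\<exists>D. \<forall>W R V w. w \<in> (W :: 'w set) \<longrightarrow> \<not> sem W R V (holds (map num ns)) w \<longrightarrow>
    (\<exists>s\<in>set D. \<not> sem W R V (subst (\<lambda>x. num (s x)) (prog_fm G)) w)"
  using assms
proof induction
  case (rule ps c s)
  let ?P = "\<lambda>ns D. \<forall>W R V w. w \<in> (W :: 'w set) \<longrightarrow> \<not> sem W R V (holds (map num ns)) w \<longrightarrow>
    (\<exists>s\<in>set D. \<not> sem W R V (subst (\<lambda>x. num (s x)) (prog_fm G)) w)"
  have "\<forall>p\<in>set ps. \<exists>D. ?P (map (gnd s) p) D" using rule.IH by blast
  then obtain D where D: "\<And>p. p \<in> set ps \<Longrightarrow> ?P (map (gnd s) p) (D p)" by metis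
  have "?P (map (gnd s) c) (s # concat (map D ps))"
  proof (intro allI impI)
    fix W :: "'w set" and R V w
    assume w: "w \<in> W" and c: "\<not> sem W R V (holds (map num (map (gnd s) c))) w"
    let ?V = "\<lambda>x. sem W R V (num (s x))"
    have h: "sem W R ?V (holds (map trm p)) w = sem W R V (holds (map num (map (gnd s) p))) w"
      for p
      unfolding map_map comp_def by (rule sem_holds_cong) (rule sem_trm_num[OF refl])
    show "\<exists>s\<in>set (s # concat (map D ps)).
        \<not> sem W R V (subst (\<lambda>x. num (s x)) (prog_fm G)) w"
    proof (cases "\<forall>p\<in>set ps. sem W R V (holds (map num (map (gnd s) p))) w")
      case True
      then have "\<not> sem W R ?V (prog_fm G) w"
        using w c rule.hyps(1) h unfolding sem_prog_fm by blast
      then show ?thesis by (auto simp: sem_subst)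
    next
      case False
      then show ?thesis using D w by fastforce
    qed
  qed
  then show ?case by blast
qed

text \<open>The unifier: since \<open>A\<close> is a universal formula, each model decides globally which ground
  instances of \<open>A\<close> fail, and the first failing one in \<open>D\<close> supplies the values of all variables.\<close>

primrec first_refuted :: "fm \<Rightarrow> (nat \<Rightarrow> nat) list \<Rightarrow> nat \<Rightarrow> fm" where
  "first_refuted A [] x = Var x"
| "first_refuted A (s # D) x =
     And (Imp (Neg (subst (\<lambda>y. num (s y)) A)) (num (s x)))
         (Imp (subst (\<lambda>y. num (s y)) A) (first_refuted A D x))"

lemma sem_first_refuted:
  assumes "\<exists>s\<in>set D. \<not> sem W R V (subst (\<lambda>x. num (s x)) (Univ A)) w"
  shows "\<exists>s\<in>set D. \<not> sem W R V (subst (\<lambda>x. num (s x)) (Univ A)) w \<and>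
    (\<lambda>x. sem W R V (first_refuted (Univ A) D x)) = (\<lambda>x. sem W R V (num (s x)))"
  using assms
proof (induction D)
  case (Cons t D)
  let ?B = "subst (\<lambda>x. num (t x)) (Univ A)"
  have glob: "sem W R V ?B u \<longleftrightarrow> sem W R V ?B w" for u by simp
  show ?case
  proof (cases "sem W R V ?B w")
    case True
    then have "(\<lambda>x. sem W R V (first_refuted (Univ A) (t # D) x)) =
        (\<lambda>x. sem W R V (first_refuted (Univ A) D x))"
      using glob by (simp add: fun_eq_iff del: subst.simps)
    then show ?thesis using Cons True by (auto simp del: subst.simps first_refuted.simps)
  next
    case False
    then have "(\<lambda>x. sem W R V (first_refuted (Univ A) (t # D) x)) = (\<lambda>x. sem W R V (num (t x)))"
      using glob by (simp add: fun_eq_iff del: subst.simps)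
    then show ?thesis using False by (auto simp del: subst.simps first_refuted.simps)
  qed
qed simp

lemma (in normal_logic) derivable_unifiable:
  assumes "derivable G ns"
  shows "\<exists>s. subst s (query_fm G ns) \<in> L"
proof -
  obtain D where D: "\<And>W R V w. w \<in> (W :: fm set set) \<Longrightarrow> \<not> sem W R V (holds (map num ns)) w \<Longrightarrow>
    \<exists>s\<in>set D. \<not> sem W R V (subst (\<lambda>x. num (s x)) (prog_fm G)) w"
    \<comment> \<open>The models in \<open>completeness\<close> have sets of formulas as
      worlds.\<close>
    using derivable_refutations[OF assms, where 'w = "fm set"] by blast
  let ?\<sigma> = "first_refuted (prog_fm G) D"
  have "subst ?\<sigma> (query_fm G ns) \<in> L"
  proof (rule completeness)
    fix W :: "fm set set" and R V w
    assume w: "w \<in> W"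
    let ?V = "\<lambda>x. sem W R V (?\<sigma> x)"
    have "sem W R ?V (holds (map num ns)) w" if prog: "sem W R ?V (prog_fm G) w"
    proof (rule ccontr)
      assume "\<not> sem W R ?V (holds (map num ns)) w"
      then have "\<not> sem W R V (holds (map num ns)) w"
        using sem_holds_cong[of ns W R ?V num V num w w, OF sem_num_irrelevant] by blast
      from sem_first_refuted[OF D[OF w this, unfolded prog_fm_def]]
      obtain s where "\<not> sem W R V (subst (\<lambda>x. num (s x)) (prog_fm G)) w"
        "?V = (\<lambda>x. sem W R V (num (s x)))"
        unfolding prog_fm_def by blast
      then show False using prog by (simp add: sem_subst)
    qed
    then show "sem W R V (subst ?\<sigma> (query_fm G ns)) w"
      by (simp add: sem_subst query_fm_def)
  qed
  then show ?thesis by blast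
qed

section \<open>A transitive frame for a set of facts\<close>

text \<open>\<open>NN\<close> is the chain of numbers, \<open>NN (Suc n)\<close> standing for \<open>n\<close>; \<open>RR\<close> is reflexive and visible
  from everything outside that chain; \<open>BB j\<close> marks argument positions; \<open>TT j n\<close> says that
  argument \<open>j\<close> equals \<open>n\<close>; and \<open>EE xs\<close> is the fact with argument list \<open>xs\<close>.\<close>

datatype pt = NN nat | RR | BB nat | TT nat nat | EE "nat list"

text \<open>The topmost number and the topmost position seen from \<open>TT j n\<close> are
  \<open>NN (Suc n)\<close> and \<open>BB j\<close>; this is what \<open>imm\<close> reads
  off.\<close>

fun acc :: "pt \<Rightarrow> pt \<Rightarrow> bool" where
  "acc (NN m) v = (\<exists>n<m. v = NN n)"
| "acc RR v = (v = RR)"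
| "acc (BB j) v = (v = NN 0 \<or> v = RR \<or> (\<exists>i<j. v = BB i))"
| "acc (TT j n) v = ((\<exists>i\<le>Suc n. v = NN i) \<or> v = RR \<or> (\<exists>i\<le>j. v = BB i))"
| "acc (EE xs) v = ((\<exists>i. v = NN i) \<or> v = RR \<or> (\<exists>i. v = BB i) \<or>
     (\<exists>j<length xs. v = TT j (xs ! j)))"

lemma acc_trans: "acc x y \<Longrightarrow> acc y z \<Longrightarrow> acc x z"
  by (cases x; cases y; force)

definition pts :: "nat list set \<Rightarrow> pt set" where
  "pts D = {w. \<forall>xs. w = EE xs \<longrightarrow> xs \<in> D}"

lemma in_pts [simp]: "NN n \<in> pts D" "RR \<in> pts D" "BB n \<in> pts D" "TT j n \<in> pts D"
  "EE xs \<in> pts D \<longleftrightarrow> xs \<in> D"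
  by (auto simp: pts_def)

context
  fixes D :: "nat list set" and V :: "nat \<Rightarrow> pt \<Rightarrow> bool"
begin

abbreviation sat :: "fm \<Rightarrow> pt \<Rightarrow> bool" where
  "sat \<equiv> sem (pts D) acc V"

lemma sat_Dia:
  "sat (Dia a) (NN m) \<longleftrightarrow> (\<exists>n<m. sat a (NN n))"
  "sat (Dia a) RR \<longleftrightarrow> sat a RR"
  "sat (Dia a) (BB j) \<longleftrightarrow> sat a (NN 0) \<or> sat a RR \<or> (\<exists>i<j. sat a (BB i))"
  "sat (Dia a) (TT j n) \<longleftrightarrow> (\<exists>i\<le>Suc n. sat a (NN i)) \<or> sat a RR \<or> (\<exists>i\<le>j. sat a (BB i))"
  "sat (Dia a) (EE xs) \<longleftrightarrow> (\<exists>i. sat a (NN i)) \<or> sat a RR \<or> (\<exists>i. sat a (BB i)) \<or>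
     (\<exists>j<length xs. sat a (TT j (xs ! j)))"
  by (auto simp: bex_simps)

text \<open>Every point except \<open>RR\<close> is the dead end \<open>NN 0\<close> or sees
  it.\<close>

lemma sat_rho: "sat rho w \<longleftrightarrow> w = RR"
proof -
  have d: "sat (Dia Tru) w \<longleftrightarrow> w \<noteq> NN 0" for w
    by (cases w) (auto simp: sat_Dia simp del: sem_Dia)
  have "sat rho w \<longleftrightarrow> sat (Dia Tru) w \<and> \<not> sat (Dia (Neg (Dia Tru))) w"
    by (simp add: rho_def)
  also have "\<dots> \<longleftrightarrow> w = RR"
    by (cases w) (auto simp: sat_Dia d simp del: sem_Dia dest: spec[of _ 0])
  finally show ?thesis .
qed

lemma sat_Dia_rho: "sat (Dia rho) w \<longleftrightarrow> (\<forall>n. w \<noteq> NN n)"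
  by (cases w) (auto simp: sat_Dia sat_rho simp del: sem_Dia)

lemma sat_numeric: "sat numeric w \<longleftrightarrow> (\<exists>n. w = NN (Suc n))"
proof -
  have "sat (Dia Tru) (NN m) \<longleftrightarrow> m \<noteq> 0" for m
    by (auto simp: sat_Dia simp del: sem_Dia)
  then show ?thesis
    unfolding numeric_def sem.simps sat_Dia_rho
    by (cases w) (auto simp: gr0_conv_Suc not0_implies_Suc)
qed

lemma sat_nxt_empty: "(\<And>w. w \<in> pts D \<Longrightarrow> \<not> sat a w) \<Longrightarrow> \<not> sat (nxt a) w"
  by (auto simp: nxt_def imm_def)

lemma sat_imm_NN:
  assumes "\<And>w. w \<in> pts D \<Longrightarrow> sat a w \<longleftrightarrow> w = NN (Suc n)"
  shows "sat (imm a) (NN m) \<longleftrightarrow> m = Suc (Suc n)" "sat (imm a) (TT j k) \<longleftrightarrow> k = n"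
  using assms by (auto simp: imm_def sat_Dia simp del: sem_Dia dest: spec[of _ "Suc (Suc n)"])

lemma sat_nxt_NN:
  assumes "\<And>w. w \<in> pts D \<Longrightarrow> sat a w \<longleftrightarrow> w = NN (Suc n)"
  shows "sat (nxt a) w \<longleftrightarrow> w = NN (Suc (Suc n))"
  using sat_imm_NN(1)[OF assms] unfolding nxt_def sem.simps sat_Dia_rho by (cases w) auto

lemma sat_num: "sat (num n) w \<longleftrightarrow> w = NN (Suc n)"
proof (induction n arbitrary: w)
  case 0
  have "sat (imm Tru) (NN m) \<longleftrightarrow> m = Suc 0" for m
    by (auto simp: imm_def sat_Dia simp del: sem_Dia dest: spec[of _ "Suc 0"])
  then show ?case unfolding num.simps nxt_def sem.simps sat_Dia_rho by (cases w) auto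
next
  case (Suc n)
  then show ?case by (simp add: sat_nxt_NN)
qed

lemma sat_Dia_zero: "sat (Dia (num 0)) (BB j) \<longleftrightarrow> False" "sat (Dia (num 0)) (TT j n)"
  "sat (Dia (num 0)) (EE xs)" "sat (Dia (num 0)) RR \<longleftrightarrow> False"
  by (auto simp: sat_Dia sat_num simp del: sem_Dia num.simps)

lemma sat_pos: "w \<in> pts D \<Longrightarrow> sat (pos j) w \<longleftrightarrow> w = BB j"
proof (induction j arbitrary: w)
  case 0
  have "sat (Box Fls) w \<longleftrightarrow> \<not> sat (Dia Tru) w" for w by simp
  then have dead: "sat (Box Fls) w \<longleftrightarrow> w = NN 0" for w
    by (cases w) (auto simp: sat_Dia simp del: sem_Dia sem.simps(4))
  have "sat branch w \<longleftrightarrow> (\<forall>n. w \<noteq> NN n) \<and> w \<noteq> RR" for w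
    unfolding branch_def sem.simps(3) sat_Dia_rho
    by (cases w) (auto simp: sat_Dia dead simp del: sem_Dia sem.simps(4))
  then show ?case
    by (cases w) (auto simp: sat_Dia simp del: sem_Dia)
next
  case (Suc j)
  have 1: "sat (Dia (pos j)) (NN m) = False" "sat (Dia (pos j)) RR = False"
    "sat (Dia (pos j)) (BB i) \<longleftrightarrow> j < i" "sat (Dia (pos j)) (TT i n) \<longleftrightarrow> j \<le> i" for m i n
    using Suc.IH by (auto simp: sat_Dia simp del: sem_Dia pos.simps)
  show ?case
    \<comment> \<open>The instance \<open>Suc j\<close> rules out \<open>BB i\<close> with
      \<open>i > Suc j\<close>: it sees \<open>BB (Suc j)\<close>, which sees
      \<open>BB j\<close>.\<close>
    by (cases w) (auto simp: imm_def 1 sat_Dia_zero sat_Dia[of "Dia _"]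
        simp del: sem_Dia num.simps dest: spec[of _ "Suc j"])
qed

lemma sat_imm_pos: 
  "sat (imm (pos j)) (NN m) \<longleftrightarrow> False" "sat (imm (pos j)) RR \<longleftrightarrow> False"
  "sat (imm (pos j)) (BB i) \<longleftrightarrow> i = Suc j"
  "sat (imm (pos j)) (TT i n) \<longleftrightarrow> i = j"
proof -
  have 1: "sat (Dia (pos j)) (NN m) = False" "sat (Dia (pos j)) RR = False"
    "sat (Dia (pos j)) (BB i) \<longleftrightarrow> j < i" "sat (Dia (pos j)) (TT i n) \<longleftrightarrow> j \<le> i" for m i n
    using sat_pos by (auto simp: sat_Dia simp del: sem_Dia pos.simps)
  show "sat (imm (pos j)) (NN m) \<longleftrightarrow> False" "sat (imm (pos j)) RR \<longleftrightarrow> False"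
    "sat (imm (pos j)) (BB i) \<longleftrightarrow> i = Suc j"
    "sat (imm (pos j)) (TT i n) \<longleftrightarrow> i = j"
    by (auto simp: imm_def 1 sat_Dia[of "Dia _"] simp del: sem_Dia dest: spec[of _ "Suc j"])
qed

text \<open>The value \<open>None\<close> is for formulas false everywhere: an arbitrary valuation
  may make a variable true at no numeric point.\<close>

definition denotes :: "fm \<Rightarrow> nat option \<Rightarrow> bool" where
  "denotes a r \<longleftrightarrow> (\<forall>w\<in>pts D. sat a w \<longleftrightarrow> (\<exists>n. r = Some n \<and> w = NN (Suc n)))"

lemma denotes_num: "denotes (num n) (Some n)"
  by (simp add: denotes_def sat_num)

lemma denotes_nxt:
  assumes "denotes a r"
  shows "denotes (nxt a) (map_option Suc r)"
proof (cases r)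
  case None
  then show ?thesis using assms sat_nxt_empty[of a] by (simp add: denotes_def)
next
  case (Some n)
  then show ?thesis using assms sat_nxt_NN[of a n] by (simp add: denotes_def)
qed

lemma denotes_pick: "\<exists>r. denotes (pick x) r"
proof -
  have num: "sat (And (Var x) numeric) w \<longleftrightarrow> (\<exists>n. w = NN (Suc n) \<and> V x (NN (Suc n)))" for w
    by (auto simp: sat_numeric)
  show ?thesis
  proof (cases "\<exists>n. V x (NN (Suc n))")
    case False
    then have "denotes (pick x) None"
      unfolding denotes_def pick_def sem.simps(3)[of _ _ _ "And (Var x) numeric"] num by simp
    then show ?thesis by blast
  next
    case True
    \<comment> \<open>A chain point sees exactly the lower ones, so \<open>pick x\<close> retains
      the lowest numeric point at which \<open>x\<close> is true.\<close>
    define n where "n = (LEAST n. V x (NN (Suc n)))"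
    have n: "V x (NN (Suc n))" "\<And>k. V x (NN (Suc k)) \<Longrightarrow> n \<le> k"
      using True unfolding n_def by (auto intro: LeastI Least_le)
    have d: "sat (Dia (And (Var x) numeric)) (NN (Suc m)) \<longleftrightarrow> (\<exists>k<m. V x (NN (Suc k)))" for m
      unfolding sat_Dia num by auto
    have "sat (pick x) w \<longleftrightarrow> (\<exists>m. w = NN (Suc m) \<and> V x (NN (Suc m)) \<and> (\<forall>k<m. \<not> V x (NN (Suc k))))"
      for w
    proof -
      have "sat (pick x) w \<longleftrightarrow> sat (And (Var x) numeric) w \<and> \<not> sat (Dia (And (Var x) numeric)) w"
        by (simp add: pick_def)
      then show ?thesis unfolding num using d by (auto simp del: sem_Dia)
    qed
    also have "\<dots> w \<longleftrightarrow> w = NN (Suc n)" for w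
      using n by (metis leD le_neq_implies_less)
    finally have "denotes (pick x) (Some n)" by (simp add: denotes_def)
    then show ?thesis by blast
  qed
qed

text \<open>The only point seen from \<open>EE xs\<close> that can witness position \<open>j\<close>
  is \<open>TT j (xs ! j)\<close>. An argument without value makes both sides false.\<close>

lemma sat_tips_EE:
  assumes "list_all2 denotes as rs"
  shows "sat (tips j as) (EE xs) \<longleftrightarrow> map Some (drop j xs) = rs"
  using assms
proof (induction arbitrary: j rule: list_all2_induct)
  case Nil
  have "sat (Dia (And (imm (pos j)) (Dia (num 0)))) (EE xs) \<longleftrightarrow> j < length xs"
    by (auto simp: sat_Dia sat_imm_pos sat_num simp del: sem_Dia num.simps)
  then show ?case by (auto simp del: sem_Dia num.simps)
next
  case (Cons a as r rs)
  have t: "sat (imm a) (TT i k) \<longleftrightarrow> r = Some k" for i k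
  proof (cases r)
    case None
    then show ?thesis using Cons.hyps(1) by (auto simp: denotes_def imm_def)
  next
    case (Some n)
    then show ?thesis using Cons.hyps(1) sat_imm_NN(2)[of a n] by (auto simp: denotes_def)
  qed
  have b: "\<not> sat (imm a) (BB i)" for i
    using Cons.hyps(1) by (auto simp: denotes_def imm_def sat_Dia simp del: sem_Dia)
  have "sat (Dia (And (imm (pos j)) (imm a))) (EE xs) \<longleftrightarrow> j < length xs \<and> Some (xs ! j) = r"
    by (auto simp: sat_Dia sat_imm_pos t b simp del: sem_Dia)
  then have "sat (tips j (a # as)) (EE xs) \<longleftrightarrow>
      j < length xs \<and> Some (xs ! j) = r \<and> map Some (drop (Suc j) xs) = rs"
    using Cons.IH by (simp del: sem_Dia)
  also have "\<dots> \<longleftrightarrow> map Some (drop j xs) = r # rs"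
  proof (cases "j < length xs")
    case True
    then show ?thesis by (simp flip: Cons_nth_drop_Suc)
  qed simp
  finally show ?case .
qed

text \<open>Only fact points see points \<open>TT j n\<close>. The empty list is excluded since
  \<open>tips j []\<close> also holds at \<open>RR\<close>.\<close>

lemma sat_tips_not_EE:
  assumes "list_all2 denotes as rs" "as \<noteq> []" "sat (tips j as) w"
  shows "\<exists>xs. w = EE xs"
proof -
  obtain a bs r where a: "as = a # bs" "denotes a r"
    using assms(1,2) by (cases as) (auto simp: list_all2_Cons1)
  then have "sat (Dia (And (imm (pos j)) (imm a))) w" using assms(3) by simp
  moreover have "\<not> sat (imm a) (BB i)" for i
    using a(2) by (auto simp: denotes_def imm_def sat_Dia simp del: sem_Dia)
  ultimately show ?thesis
    by (cases w) (auto simp: sat_Dia sat_imm_pos simp del: sem_Dia)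
qed

lemma sat_holds:
  assumes "list_all2 denotes as rs" "as \<noteq> []"
  shows "sat (holds as) w \<longleftrightarrow> (\<exists>xs\<in>D. map Some xs = rs)"
proof -
  have "sat (holds as) w \<longleftrightarrow> (\<exists>u\<in>pts D. sat (tips 0 as) u)" by (simp add: holds_def)
  also have "\<dots> \<longleftrightarrow> (\<exists>xs\<in>D. sat (tips 0 as) (EE xs))"
    using sat_tips_not_EE[OF assms] in_pts(5) by metis
  also have "\<dots> \<longleftrightarrow> (\<exists>xs\<in>D. map Some xs = rs)"
    by (simp add: sat_tips_EE[OF assms(1)])
  finally show ?thesis .
qed

text \<open>An arbitrary valuation acts as a partial assignment of numbers. If the premises hold,
  all their variables have values, by safety so do those of the conclusion, and closure of
  \<open>D\<close> applies.\<close>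

lemma sat_prog_fm:
  assumes "closed_under G D" "safe G"
  shows "sat (prog_fm G) w"
  unfolding sem_prog_fm
proof (intro ballI impI, clarify)
  fix u ps c
  assume cl: "(ps, c) \<in> set G" and ps: "\<forall>p\<in>set ps. sat (holds (map trm p)) u"
  obtain v where v: "\<And>x. denotes (pick x) (v x)" using denotes_pick by metis
  \<comment> \<open>Outside \<open>dom v\<close> this assignment is unspecified; \<open>val\<close>
    gives a value only to terms all of whose variables have one.\<close>
  let ?s = "\<lambda>x. the (v x)"
  define val where "val t = (if tvars t \<subseteq> dom v then Some (gnd ?s t) else None)" for t
  have den: "denotes (trm t) (val t)" for t
  proof (induction t)
    case Ze
    show ?case using denotes_num[of 0] by (simp add: val_def)
  next
    case (Va x)
    have "val (Va x) = v x" by (cases "v x") (auto simp: val_def)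
    then show ?case using v by simp
  next
    case (Su t)
    have "val (Su t) = map_option Suc (val t)" by (simp add: val_def)
    then show ?case using denotes_nxt[OF Su] by simp
  qed
  have val: "map Some xs = map val ts \<longleftrightarrow> avars ts \<subseteq> dom v \<and> xs = map (gnd ?s) ts" for xs ts
  proof (induction ts arbitrary: xs)
    case (Cons t ts)
    show ?case
      by (cases xs; cases "tvars t \<subseteq> dom v") (simp_all add: Cons.IH val_def[of t] conj_ac)
  qed simp
  have holds: "sat (holds (map trm ts)) u \<longleftrightarrow> avars ts \<subseteq> dom v \<and> map (gnd ?s) ts \<in> D"
    if "ts \<noteq> []" for ts
  proof -
    have "list_all2 denotes (map trm ts) (map val ts)"
      using den by (simp add: list_all2_conv_all_nth)
    from sat_holds[OF this] that show ?thesis unfolding val by auto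
  qed
  have ne: "c \<noteq> []" "[] \<notin> set ps" and vars: "avars c \<subseteq> (\<Union>p\<in>set ps. avars p)"
    using bspec[OF assms(2)[unfolded safe_def] cl] by simp_all
  have "\<forall>p\<in>set ps. avars p \<subseteq> dom v \<and> map (gnd ?s) p \<in> D"
  proof
    fix p assume p: "p \<in> set ps"
    then have "p \<noteq> []" using ne(2) by blast
    then show "avars p \<subseteq> dom v \<and> map (gnd ?s) p \<in> D" using holds ps p by blast
  qed
  moreover from this have "map (gnd ?s) c \<in> D"
    using bspec[OF assms(1)[unfolded closed_under_def] cl] by simp
  ultimately have "avars c \<subseteq> dom v \<and> map (gnd ?s) c \<in> D"
    using vars by blast
  then show "sat (holds (map trm c)) u" using holds ne(1) by blast
qed

lemma sat_holds_num: "ns \<noteq> [] \<Longrightarrow> sat (holds (map num ns)) w \<longleftrightarrow> ns \<in> D"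
proof -
  assume "ns \<noteq> []"
  moreover have "list_all2 denotes (map num ns) (map Some ns)"
    by (simp add: list_all2_conv_all_nth denotes_num)
  ultimately show ?thesis using sat_holds[of "map num ns" "map Some ns" w]
    by (auto simp: inj_map_eq_map)
qed

end

text \<open>A substitution merely changes the valuation, and \<open>sat_prog_fm\<close> covers all
  of them.\<close>

lemma unifiable_imp_in_closed:
  assumes "closed_under G D" "safe G" "ns \<noteq> []" "subst s (query_fm G ns) \<in> K4u"
  shows "ns \<in> D"
proof -
  have "sem (pts D) acc (\<lambda>x. sem (pts D) acc (\<lambda>_ _. False) (s x)) (query_fm G ns) RR"
    using K4u_sound[OF assms(4) acc_trans, where w = RR and W = "pts D"] by (simp add: sem_subst)
  then show ?thesis
    using assms(1-3) by (simp add: query_fm_def sat_prog_fm sat_holds_num)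
qed

section \<open>Recursive functions as Horn programs\<close>

text \<open>This supplies distinct tags. The reduction starts from the code of a program formula, so
  it never computes a tag.\<close>

instance recf :: countable
  by countable_datatype

text \<open>The first argument of a fact is a tag: 0 for being a number, 1 for the query, \<open>tagE f\<close> for
  evaluation of \<open>f\<close> (result first), and \<open>tagM f\<close> for the facts \<open>n # xs\<close> such that \<open>f\<close> is
  positive at all \<open>m # xs\<close> with \<open>m < n\<close>.\<close>

definition tagE :: "recf \<Rightarrow> nat" where "tagE f = 2 * to_nat f + 2"
definition tagM :: "recf \<Rightarrow> nat" where "tagM f = 2 * to_nat f + 3"

lemma tag_simps [simp]:
  "tagE f = tagE g \<longleftrightarrow> f = g" "tagM f = tagM g \<longleftrightarrow> f = g" "tagE f \<noteq> tagM g" "tagM g \<noteq> tagE f"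
  "tagE f \<noteq> 0" "tagM f \<noteq> 0" "tagE f \<noteq> Suc 0" "tagM f \<noteq> Suc 0"
  "0 \<noteq> tagE f" "0 \<noteq> tagM f" "Suc 0 \<noteq> tagE f" "Suc 0 \<noteq> tagM f"
  by (simp_all add: tagE_def tagM_def) presburger+

primrec numeral_tm :: "nat \<Rightarrow> tm" where
  "numeral_tm 0 = Ze"
| "numeral_tm (Suc n) = Su (numeral_tm n)"

lemma gnd_numeral_tm [simp]: "gnd s (numeral_tm n) = n"
  by (induction n) auto

lemma tvars_numeral_tm [simp]: "tvars (numeral_tm n) = {}"
  by (induction n) auto

abbreviation nat_atom :: "tm \<Rightarrow> tm list" where
  "nat_atom t \<equiv> [Ze, t]"

definition eval_atom :: "recf \<Rightarrow> tm \<Rightarrow> tm list \<Rightarrow> tm list" where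
  "eval_atom f y xs = numeral_tm (tagE f) # y # xs"

definition search_atom :: "recf \<Rightarrow> tm \<Rightarrow> tm list \<Rightarrow> tm list" where
  "search_atom f n xs = numeral_tm (tagM f) # n # xs"

text \<open>The premises \<open>nat_atom (Va i)\<close> make a clause safe even if variables of its
  conclusion occur in no other premise.\<close>

definition typed_clause :: "nat \<Rightarrow> tm list list \<Rightarrow> tm list \<Rightarrow> clause" where
  "typed_clause k ps c = (map (\<lambda>i. nat_atom (Va i)) [0..<k] @ ps, c)"

abbreviation args :: "nat \<Rightarrow> tm list" where "args a \<equiv> map Va [0..<a]"

text \<open>Terms of type \<open>recf\<close> carry no arity, hence the parameter \<open>a\<close>;
  an empty list marks arities without evaluations. Low variables are arguments (parameters for
  \<open>Prec\<close>), higher ones the predecessor, intermediate results and the value.\<close>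

primrec rec_clauses :: "recf \<Rightarrow> nat \<Rightarrow> clause list" where
  "rec_clauses Zero a = [typed_clause a [] (eval_atom Zero Ze (args a))]"
| "rec_clauses Succ a = (if a = 0 then [] else
     [typed_clause a [] (eval_atom Succ (Su (Va 0)) (args a))])"
| "rec_clauses (Proj i) a = (if a \<le> i then [] else
     [typed_clause a [] (eval_atom (Proj i) (Va i) (args a))])"
| "rec_clauses (Comp f gs) a =
     typed_clause (a + length gs + 1)
       (eval_atom f (Va (a + length gs)) (map (\<lambda>i. Va (a + i)) [0..<length gs]) #
        map (\<lambda>i. eval_atom (gs ! i) (Va (a + i)) (args a)) [0..<length gs])
       (eval_atom (Comp f gs) (Va (a + length gs)) (args a)) #
     rec_clauses f (length gs) @ concat (map (\<lambda>r. r a) (map rec_clauses gs))"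
| "rec_clauses (Prec f g) a = (case a of 0 \<Rightarrow> [] | Suc b \<Rightarrow>
     typed_clause (b + 1) [eval_atom f (Va b) (args b)]
       (eval_atom (Prec f g) (Va b) (Ze # args b)) #
     typed_clause (b + 3)
       [eval_atom (Prec f g) (Va (b + 1)) (Va b # args b),
        eval_atom g (Va (b + 2)) (Va (b + 1) # Va b # args b)]
       (eval_atom (Prec f g) (Va (b + 2)) (Su (Va b) # args b)) #
     rec_clauses f b @ rec_clauses g (b + 2))"
| "rec_clauses (Mu f) a =
     typed_clause a [] (search_atom f Ze (args a)) #
     typed_clause (a + 2)
       [search_atom f (Va a) (args a), eval_atom f (Su (Va (a + 1))) (Va a # args a)]
       (search_atom f (Su (Va a)) (args a)) #
     typed_clause (a + 1)
       [search_atom f (Va a) (args a), eval_atom f Ze (Va a # args a)]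
       (eval_atom (Mu f) (Va a) (args a)) #
     rec_clauses f (a + 1)"

text \<open>The query has its own tag, independent of the function: in the diagonal argument the function
  \<open>h\<close> itself computes the code of the query.\<close>

definition zero_query :: "nat \<Rightarrow> nat list" where "zero_query n = [1, n]"

definition rec_program :: "recf \<Rightarrow> clause list" where
  "rec_program f =
     [([], nat_atom Ze), ([nat_atom (Va 0)], nat_atom (Su (Va 0))),
      ([eval_atom f Ze [Va 0]], [Su Ze, Va 0])] @ rec_clauses f 1"

definition facts :: "recf \<Rightarrow> nat list set" where
  "facts h = {[0, n] | n. True} \<union> {[1, n] | n. recf_eval h [n] 0} \<union>
     {tagE f # y # xs | f y xs. recf_eval f xs y} \<union>
     {tagM f # n # xs | f n xs. \<forall>m<n. \<exists>k. recf_eval f (m # xs) (Suc k)}"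

lemma facts_simps [simp]:
  "[0, n] \<in> facts h"
  "[Suc 0, n] \<in> facts h \<longleftrightarrow> recf_eval h [n] 0"
  "tagE f # y # xs \<in> facts h \<longleftrightarrow> recf_eval f xs y"
  "tagM f # n # xs \<in> facts h \<longleftrightarrow> (\<forall>m<n. \<exists>k. recf_eval f (m # xs) (Suc k))"
  by (auto simp: facts_def)

lemma map_gnd_atoms [simp]:
  "map (gnd s) (eval_atom f y xs) = tagE f # gnd s y # map (gnd s) xs"
  "map (gnd s) (search_atom f n xs) = tagM f # gnd s n # map (gnd s) xs"
  "avars (eval_atom f y xs) = tvars y \<union> avars xs"
  "avars (search_atom f y xs) = tvars y \<union> avars xs"
  "eval_atom f y xs \<noteq> []" "search_atom f y xs \<noteq> []"
  "[] \<noteq> eval_atom f y xs" "[] \<noteq> search_atom f y xs"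
  by (simp_all add: eval_atom_def search_atom_def)

section \<open>Soundness of the clauses for evaluation\<close>

lemma closed_under_append [simp]:
  "closed_under (G @ H) D \<longleftrightarrow> closed_under G D \<and> closed_under H D"
  by (auto simp: closed_under_def)

lemma closed_under_concat [simp]:
  "closed_under (concat Gs) D \<longleftrightarrow> (\<forall>G\<in>set Gs. closed_under G D)"
  by (auto simp: closed_under_def)

lemma closed_under_Nil [simp]: "closed_under [] D"
  by (simp add: closed_under_def)

lemma closed_under_Cons [simp]:
  "closed_under ((ps, c) # G) D \<longleftrightarrow>
     (\<forall>s. (\<forall>p\<in>set ps. map (gnd s) p \<in> D) \<longrightarrow> map (gnd s) c \<in> D) \<and> closed_under G D"
  by (auto simp: closed_under_def)

lemma closed_under_typed_clause [simp]:
  "closed_under (typed_clause k ps c # G) (facts h) \<longleftrightarrow>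
     (\<forall>s. (\<forall>p\<in>set ps. map (gnd s) p \<in> facts h) \<longrightarrow> map (gnd s) c \<in> facts h) \<and>
     closed_under G (facts h)"
  by (auto simp: typed_clause_def)

text \<open>Each evaluation clause mirrors a rule of \<open>recf_eval\<close>; the search clauses
  lengthen the initial segment of positive values by one.\<close>

lemma closed_rec_clauses: "closed_under (rec_clauses f a) (facts h)"
proof (induction f arbitrary: a)
  case Zero
  show ?case by (simp add: recf_eval.zero)
next
  case Succ
  then show ?case using recf_eval.succ by (simp add: upt_conv_Cons)
next
  case (Proj i)
  show ?case using recf_eval.proj[of i "map s [0..<a]" for s] by (simp add: comp_def)
next
  case (Comp f gs)
  have "recf_eval (Comp f gs) (map s [0..<a]) (s (a + length gs))"
    if "recf_eval f (map (\<lambda>i. s (a + i)) [0..<length gs]) (s (a + length gs))"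
      "\<forall>i\<in>{0..<length gs}. recf_eval (gs ! i) (map s [0..<a]) (s (a + i))" for s
    by (rule recf_eval.comp[OF _ _ that(1)]) (use that(2) in auto)
  then show ?case using Comp by (simp add: comp_def)
next
  case (Prec f g)
  then show ?case
    using recf_eval.prec0 recf_eval.precS by (auto simp: comp_def split: nat.split)
next
  case (Mu f)
  then show ?case
    using recf_eval.mu by (auto simp: comp_def less_Suc_eq)
qed

lemma closed_rec_program: "closed_under (rec_program f) (facts f)"
  using closed_rec_clauses[of f 1 f] by (simp add: rec_program_def)

section \<open>Safety of the clauses\<close>

lemma safe_append [simp]: "safe (G @ H) \<longleftrightarrow> safe G \<and> safe H"
  by (simp add: safe_def ball_Un)

lemma safe_Nil [simp]: "safe []"
  by (simp add: safe_def)

lemma safe_concat [simp]: "safe (concat Gs) \<longleftrightarrow> (\<forall>G\<in>set Gs. safe G)"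
  by (induction Gs) simp_all

lemma safe_Cons [simp]:
  "safe ((ps, c) # G) \<longleftrightarrow>
     c \<noteq> [] \<and> [] \<notin> set ps \<and> avars c \<subseteq> (\<Union>p\<in>set ps. avars p) \<and> safe G"
  by (simp add: safe_def)

lemma safe_typed_clause:
  assumes "c \<noteq> []" "[] \<notin> set ps" "\<forall>t\<in>set c. \<forall>x\<in>tvars t. x < k"
  shows "safe (typed_clause k ps c # G) \<longleftrightarrow> safe G"
  using assms by (auto simp: typed_clause_def)

lemma safe_rec_clauses: "safe (rec_clauses f a)"
proof (induction f arbitrary: a)
  case (Prec f g)
  then show ?case
    by (cases a) (simp_all add: safe_typed_clause eval_atom_def image_iff)
qed (simp_all add: safe_typed_clause eval_atom_def search_atom_def image_iff)

lemma safe_rec_program: "safe (rec_program f)"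
  using safe_rec_clauses[of f 1] by (simp add: rec_program_def)

section \<open>Every evaluation is derivable\<close>

lemma derivable_typed_clause:
  assumes "typed_clause k ps c \<in> set G" "\<And>n. derivable G [0, n]"
    "\<And>p. p \<in> set ps \<Longrightarrow> derivable G (map (gnd s) p)"
  shows "derivable G (map (gnd s) c)"
  using assms by (intro derivable.rule[of _ c G s]) (auto simp: typed_clause_def)

text \<open>Assignments below are lookups in a concatenated list whose order follows the variable
  numbering of \<open>rec_clauses\<close>.\<close>

lemma map_nth_append:
  "map (\<lambda>i. (xs @ ys) ! i) [0..<length xs] = xs"
  "map (\<lambda>i. (xs @ ys @ zs) ! (length xs + i)) [0..<length ys] = ys"
  by (rule nth_equalityI; simp add: nth_append)+

lemma map_gnd_args [simp]: "map (gnd (\<lambda>i. (xs @ ys) ! i)) (args (length xs)) = xs"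
  using map_nth_append(1)[of xs ys] by (simp add: comp_def)

lemma nth_append_simps [simp]:
  "(xs @ y # zs) ! Suc (length xs) = zs ! 0" "(xs @ y # zs) ! Suc (Suc (length xs)) = zs ! 1"
  by (simp_all add: nth_append)

lemma derivable_eval:
  assumes nat: "\<And>n. derivable G [0, n]" and "recf_eval f xs y"
    and "set (rec_clauses f (length xs)) \<subseteq> set G"
  shows "derivable G (tagE f # y # xs)"
  using assms(2,3)
proof induction
  case (zero xs)
  have "derivable G (map (gnd (\<lambda>i. (xs @ []) ! i)) (eval_atom Zero Ze (args (length xs))))"
    by (rule derivable_typed_clause[OF _ nat]) (use zero in auto)
  then show ?case by (simp del: append_Nil2 map_map)
next
  case (succ x xs)
  have "derivable G (map (gnd (\<lambda>i. ((x # xs) @ []) ! i))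
      (eval_atom Succ (Su (Va 0)) (args (length (x # xs)))))"
    by (rule derivable_typed_clause[OF _ nat]) (use succ in auto)
  then show ?case by (simp only: map_gnd_atoms map_gnd_args) simp
next
  case (proj i xs)
  have "derivable G (map (gnd (\<lambda>i. (xs @ []) ! i)) (eval_atom (Proj i) (Va i) (args (length xs))))"
    by (rule derivable_typed_clause[OF _ nat]) (use proj in auto)
  then show ?case by (simp only: map_gnd_atoms map_gnd_args) simp
next
  case (comp ys gs xs f z)
  let ?s = "\<lambda>i. (xs @ ys @ [z]) ! i" and ?a = "length xs" and ?n = "length gs"
  have cl: "set (rec_clauses f (length ys)) \<subseteq> set G"
    "i < ?n \<Longrightarrow> set (rec_clauses (gs ! i) (length xs)) \<subseteq> set G" for i
    using comp.prems comp.hyps(1) by (simp_all add: UN_subset_iff)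
  have ys: "map (gnd ?s) (map (\<lambda>i. Va (?a + i)) [0..<?n]) = ys"
    using map_nth_append(2)[of xs ys "[z]"] comp.hyps(1) by (simp add: comp_def)
  have xs: "map (gnd ?s) (args ?a) = xs" by (rule map_gnd_args)
  have z: "?s (?a + ?n) = z" "i < ?n \<Longrightarrow> ?s (?a + i) = ys ! i" for i
    using comp.hyps(1) by (simp_all add: nth_append)
  have "derivable G (map (gnd ?s) (eval_atom (Comp f gs) (Va (?a + ?n)) (args ?a)))"
  proof (rule derivable_typed_clause[OF _ nat])
    fix p
    assume p: "p \<in> set (eval_atom f (Va (?a + ?n)) (map (\<lambda>i. Va (?a + i)) [0..<?n]) #
        map (\<lambda>i. eval_atom (gs ! i) (Va (?a + i)) (args ?a)) [0..<?n])"
    then consider "p = eval_atom f (Va (?a + ?n)) (map (\<lambda>i. Va (?a + i)) [0..<?n])"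
      | i where "i < ?n" "p = eval_atom (gs ! i) (Va (?a + i)) (args ?a)" by auto
    then show "derivable G (map (gnd ?s) p)"
    proof cases
      case 1
      then show ?thesis unfolding 1 map_gnd_atoms ys gnd.simps z using comp.IH(2) cl by simp
    next
      case 2
      then show ?thesis
        unfolding 2(2) map_gnd_atoms xs gnd.simps z(2)[OF 2(1)] using comp.IH(1) cl by simp
    qed
  qed (use comp.prems in auto)
  then show ?case unfolding map_gnd_atoms xs gnd.simps z .
next
  case (prec0 f xs y g)
  let ?s = "\<lambda>i. (xs @ [y]) ! i" and ?a = "length xs"
  have "derivable G (map (gnd ?s) (eval_atom (Prec f g) (Va ?a) (Ze # args ?a)))"
    by (rule derivable_typed_clause[OF _ nat, where ps = "[eval_atom f (Va ?a) (args ?a)]"])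
      (use prec0 in \<open>auto simp del: map_map\<close>)
  then show ?case by (simp del: map_map)
next
  case (precS f g n xs y z)
  \<comment> \<open>After the parameters come the predecessor \<open>n\<close>, the value
    \<open>y\<close> at \<open>n\<close> and the new value \<open>z\<close>.\<close>
  let ?s = "\<lambda>i. (xs @ [n, y, z]) ! i" and ?a = "length xs"
  have "derivable G (map (gnd ?s) (eval_atom (Prec f g) (Va (?a + 2)) (Su (Va ?a) # args ?a)))"
    by (rule derivable_typed_clause[OF _ nat, where
        ps = "[eval_atom (Prec f g) (Va (?a + 1)) (Va ?a # args ?a),
               eval_atom g (Va (?a + 2)) (Va (?a + 1) # Va ?a # args ?a)]"])
      (use precS in \<open>auto simp del: map_map\<close>)
  then show ?case by (simp del: map_map)
next
  case (mu f n xs)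
  let ?a = "length xs"
  have cl: "set (rec_clauses f (length (m # xs))) \<subseteq> set G" for m
    using mu.prems by simp
  \<comment> \<open>The search climbs from 0 to \<open>n\<close>, using a positive value at each
    smaller argument.\<close>
  have search: "derivable G (tagM f # m # xs)" if "m \<le> n" for m
    using that
  proof (induction m)
    case 0
    have "derivable G (map (gnd (\<lambda>i. (xs @ []) ! i)) (search_atom f Ze (args ?a)))"
      by (rule derivable_typed_clause[OF _ nat]) (use mu.prems in auto)
    then show ?case by (simp del: append_Nil2 map_map)
  next
    case (Suc m)
    then obtain k where k: "derivable G (tagE f # Suc k # m # xs)"
      using mu.IH(2) cl by (meson Suc_le_lessD)
    have "derivable G (map (gnd (\<lambda>i. (xs @ [m, k]) ! i)) (search_atom f (Su (Va ?a)) (args ?a)))"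
      by (rule derivable_typed_clause[OF _ nat, where
          ps = "[search_atom f (Va ?a) (args ?a),
                 eval_atom f (Su (Va (?a + 1))) (Va ?a # args ?a)]"])
        (use mu.prems k Suc in \<open>auto simp del: map_map\<close>)
    then show ?case by (simp del: map_map)
  qed
  have "derivable G (map (gnd (\<lambda>i. (xs @ [n]) ! i)) (eval_atom (Mu f) (Va ?a) (args ?a)))"
    by (rule derivable_typed_clause[OF _ nat, where
        ps = "[search_atom f (Va ?a) (args ?a), eval_atom f Ze (Va ?a # args ?a)]"])
      (use mu.prems mu.IH(1) cl search in \<open>auto simp del: map_map\<close>)
  then show ?case by (simp del: map_map)
qed

lemma derivable_zero_query_iff: "derivable (rec_program f) (zero_query n) \<longleftrightarrow> recf_eval f [n] 0"
proof
  have "ns \<in> facts f" if "derivable (rec_program f) ns" for ns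
    using that
  proof induction
    case (rule ps c s)
    then show ?case
      using closed_rec_program[of f] unfolding closed_under_def by fast
  qed
  then show "recf_eval f [n] 0" if "derivable (rec_program f) (zero_query n)"
    using that by (fastforce simp: zero_query_def)
next
  let ?G = "rec_program f"
  have nat: "derivable ?G [0, m]" for m
  proof (induction m)
    case 0
    show ?case using derivable.rule[of "[]" "nat_atom Ze" ?G] by (simp add: rec_program_def)
  next
    case (Suc m)
    then show ?case
      using derivable.rule[of "[nat_atom (Va 0)]" "nat_atom (Su (Va 0))" ?G "\<lambda>_. m"]
      by (simp add: rec_program_def)
  qed
  assume "recf_eval f [n] 0"
  then have "derivable ?G (tagE f # 0 # [n])"
    by (rule derivable_eval[OF nat]) (auto simp: rec_program_def)
  then show "derivable ?G (zero_query n)"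
    using derivable.rule[of "[eval_atom f Ze [Va 0]]" "[Su Ze, Va 0]" ?G "\<lambda>_. n"]
    by (simp add: rec_program_def zero_query_def)
qed

section \<open>Computability of the reduction\<close>

lemma recf_eval_comp1:
  "recf_eval g xs a \<Longrightarrow> recf_eval f [a] y \<Longrightarrow> recf_eval (Comp f [g]) xs y"
  by (rule recf_eval.comp[of "[a]"]) auto

lemma recf_eval_comp2:
  "recf_eval g xs a \<Longrightarrow> recf_eval h xs b \<Longrightarrow> recf_eval f [a, b] y \<Longrightarrow>
    recf_eval (Comp f [g, h]) xs y"
  by (rule recf_eval.comp[of "[a, b]"]) (auto simp: less_Suc_eq nth_Cons')

lemma recf_eval_Proj: "i < length xs \<Longrightarrow> xs ! i = y \<Longrightarrow> recf_eval (Proj i) xs y"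
  using recf_eval.proj by blast

definition add_rec :: recf where "add_rec = Prec (Proj 0) (Comp Succ [Proj 0])"

lemma recf_eval_add: "recf_eval add_rec [m, n] (m + n)"
  unfolding add_rec_def
proof (induction m)
  case 0
  show ?case using recf_eval.prec0[OF recf_eval_Proj[of 0 "[n]" n]] by simp
next
  case (Suc m)
  show ?case
    using recf_eval.precS[OF Suc recf_eval_comp1[OF recf_eval_Proj recf_eval.succ]] by simp
qed

text \<open>The pairing \<open>prod_encode (m, n)\<close> equals
  \<open>triangle (m + n) + m\<close>.\<close>

definition triangle_rec :: recf where
  "triangle_rec = Prec Zero (Comp add_rec [Proj 0, Comp Succ [Proj 1]])"

lemma recf_eval_triangle: "recf_eval triangle_rec [n] (triangle n)"
  unfolding triangle_rec_def
proof (induction n)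
  case 0
  show ?case using recf_eval.prec0[OF recf_eval.zero] by simp
next
  case (Suc n)
  have "recf_eval (Comp add_rec [Proj 0, Comp Succ [Proj 1]]) [triangle n, n] (triangle n + Suc n)"
    by (rule recf_eval_comp2[OF recf_eval_Proj recf_eval_comp1[OF recf_eval_Proj recf_eval.succ]
          recf_eval_add]) simp_all
  then show ?case using recf_eval.precS[OF Suc] by simp
qed

definition computable :: "(nat \<Rightarrow> nat) \<Rightarrow> bool" where
  "computable F \<longleftrightarrow> (\<exists>r. \<forall>n. recf_eval r [n] (F n))"

lemma computableI: "(\<And>n. recf_eval r [n] (F n)) \<Longrightarrow> computable F"
  by (auto simp: computable_def)

lemma constant_recf: "\<exists>r. \<forall>xs. recf_eval r xs k"
proof (induction k)
  case 0
  show ?case using recf_eval.zero by blast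
next
  case (Suc k)
  then obtain r where "\<And>xs. recf_eval r xs k" by blast
  then show ?case using recf_eval_comp1[OF _ recf_eval.succ] by blast
qed

lemma computable_const: "computable (\<lambda>_. k)"
  using constant_recf[of k] by (auto simp: computable_def)

lemma computable_id: "computable (\<lambda>n. n)"
  by (rule computableI[of "Proj 0"]) (simp add: recf_eval_Proj)

lemma computable_Suc:
  assumes "computable F"
  shows "computable (\<lambda>n. Suc (F n))"
  using assms recf_eval_comp1[OF _ recf_eval.succ] unfolding computable_def by blast

lemma computable_add:
  assumes "computable F" "computable G"
  shows "computable (\<lambda>n. F n + G n)"
  using assms recf_eval_comp2[OF _ _ recf_eval_add] unfolding computable_def by blast

lemma computable_pair:
  assumes "computable F" "computable G"
  shows "computable (\<lambda>n. prod_encode (F n, G n))"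
proof -
  have "computable (\<lambda>n. triangle (F n + G n))"
    using computable_add[OF assms] recf_eval_comp1[OF _ recf_eval_triangle]
    unfolding computable_def by blast
  from computable_add[OF this assms(1)] show ?thesis by (simp add: prod_encode_def)
qed

lemma computable_iterate:
  assumes "computable G"
  shows "computable (\<lambda>n. (G ^^ n) k)"
proof -
  obtain g where g: "\<And>n. recf_eval g [n] (G n)" using assms by (auto simp: computable_def)
  obtain c where c: "\<And>xs. recf_eval c xs k" using constant_recf by blast
  have "recf_eval (Prec c (Comp g [Proj 0])) [n] ((G ^^ n) k)" for n
  proof (induction n)
    case 0
    show ?case using recf_eval.prec0[OF c] by simp
  next
    case (Suc n)
    show ?case
      using recf_eval.precS[OF Suc recf_eval_comp1[OF recf_eval_Proj g]] by simp
  qed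
  then show ?thesis by (rule computableI)
qed

section \<open>Computing codes of formulas and rules\<close>

abbreviation computable_fm :: "(nat \<Rightarrow> fm) \<Rightarrow> bool" where
  "computable_fm A \<equiv> computable (\<lambda>n. fm_code (A n))"

lemma computable_fm_Neg: "computable_fm A \<Longrightarrow> computable_fm (\<lambda>n. Neg (A n))"
  by (simp add: computable_pair computable_const)

lemma computable_fm_And:
  "computable_fm A \<Longrightarrow> computable_fm B \<Longrightarrow> computable_fm (\<lambda>n. And (A n) (B n))"
  by (simp add: computable_pair computable_const)

lemma computable_fm_Box: "computable_fm A \<Longrightarrow> computable_fm (\<lambda>n. Box (A n))"
  by (simp add: computable_pair computable_const)

lemma computable_fm_Univ: "computable_fm A \<Longrightarrow> computable_fm (\<lambda>n. Univ (A n))"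
  by (simp add: computable_pair computable_const)

text \<open>Working on codes makes \<open>fm_code (num n)\<close> an iterate of a unary computable
  function; \<open>d\<close> is the code of \<open>Dia a\<close> when \<open>c\<close> is that of
  \<open>a\<close>.\<close>

definition nxt_code :: "nat \<Rightarrow> nat" where
  "nxt_code c = (let d = prod_encode (1, prod_encode (3, prod_encode (1, c)))
     in prod_encode (2, prod_encode (prod_encode (2, prod_encode (d,
          prod_encode (1, prod_encode (1, prod_encode (3, prod_encode (1, d)))))),
        fm_code (Neg (Dia rho)))))"

lemma fm_code_nxt: "fm_code (nxt a) = nxt_code (fm_code a)"
  by (simp add: nxt_code_def nxt_def imm_def Dia_def Let_def)

lemma computable_nxt_code: "computable nxt_code"
  unfolding nxt_code_def Let_def by (intro computable_pair computable_const computable_id)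

lemma computable_fm_num: "computable_fm num"
proof -
  have "fm_code (num n) = (nxt_code ^^ n) (fm_code (num 0))" for n
    by (induction n) (simp_all add: fm_code_nxt del: num.simps(1))
  then show ?thesis using computable_iterate[OF computable_nxt_code] by simp
qed

text \<open>The query has fixed length two, so the shape of the formula is fixed and only
  \<open>num n\<close> varies.\<close>

lemma computable_fm_zero_query:
  "computable_fm (\<lambda>n. holds (map num (zero_query n)))"
  unfolding zero_query_def holds_def list.map tips.simps imm_def Ex_def Dia_def
  by (intro computable_fm_And computable_fm_Neg computable_fm_Box computable_fm_Univ
      computable_fm_num computable_const)

definition query_rule :: "clause list \<Rightarrow> nat \<Rightarrow> fm list \<times> fm" where
  "query_rule G n = ([query_fm G (zero_query n)], Fls)"

text \<open>The number \<open>c\<close> is both the code of the program formula and the queried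
  argument. \<open>Suc (prod_encode (_, 0))\<close> is the code of a one-element list.\<close>

definition query_rule_code :: "nat \<Rightarrow> nat" where
  "query_rule_code c = prod_encode (Suc (prod_encode (
     prod_encode (1, prod_encode (2, prod_encode (c,
       fm_code (Neg (holds (map num (zero_query c))))))), 0)), fm_code Fls)"

lemma computable_query_rule_code: "computable query_rule_code"
  unfolding query_rule_code_def
  by (intro computable_pair computable_Suc computable_const computable_id
      computable_fm_Neg computable_fm_zero_query)

lemma rule_code_query_rule:
  "rule_code (query_rule G (fm_code (prog_fm G))) = query_rule_code (fm_code (prog_fm G))"
  by (simp add: rule_code_def query_rule_def query_rule_code_def query_fm_def Imp_def)

section \<open>Undecidability\<close>

lemma recf_eval_deterministic: "recf_eval f xs y \<Longrightarrow> recf_eval f xs z \<Longrightarrow> y = z"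
proof (induction arbitrary: z rule: recf_eval.induct)
  case (zero xs)
  then show ?case by cases simp
next
  case (succ x xs)
  then show ?case by cases simp
next
  case (proj i xs)
  from proj.prems show ?case by cases simp
next
  case (comp ys gs xs f z z')
  from comp.prems show ?case
  proof cases
    case (comp ys')
    then have "ys = ys'"
      using comp.IH(1) comp.hyps(1) by (simp add: list_eq_iff_nth_eq)
    then show ?thesis using comp comp.IH(2) by blast
  qed
next
  case (prec0 f xs y g)
  from prec0.prems show ?case by cases (use prec0.IH in blast)
next
  case (precS f g n xs y z)
  from precS.prems show ?case by cases (use precS.IH in blast)
next
  case (mu f n xs)
  from mu.prems have z: "recf_eval f (z # xs) 0" "\<forall>m<z. \<exists>k. recf_eval f (m # xs) (Suc k)"
    by (cases; simp)+
  \<comment> \<open>The smaller of the two results would have both value 0 and a positive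
    value.\<close>
  have "\<not> n < z" using z(2) mu.IH(1) by blast
  moreover have "\<not> z < n" using z(1) mu.IH(2) by blast
  ultimately show ?case by simp
qed

lemma admissible_query_rule_iff:
  assumes "normal_logic_u L" and "L \<subseteq> K4u"
  shows "admissible L (fst (query_rule (rec_program h) n)) (snd (query_rule (rec_program h) n)) \<longleftrightarrow>
    \<not> recf_eval h [n] 0"
proof -
  interpret normal_logic L by (unfold_locales) (rule assms(1))
  have "subst s Fls \<notin> L" for s
  proof
    assume "subst s Fls \<in> L"
    then have "subst s Fls \<in> K4u" using assms(2) by blast
    \<comment> \<open>A single point with empty accessibility refutes every instance of
      \<open>Fls\<close>.\<close>
    from K4u_sound[OF this, of "\<lambda>_ _. False" "()" UNIV] show False by simp
  qed
  then have "admissible L (fst (query_rule (rec_program h) n)) (snd (query_rule (rec_program h) n)) \<longleftrightarrow>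
    \<not> (\<exists>s. subst s (query_fm (rec_program h) (zero_query n)) \<in> L)"
    by (auto simp: admissible_def query_rule_def simp del: subst.simps)
  also have "(\<exists>s. subst s (query_fm (rec_program h) (zero_query n)) \<in> L) \<longleftrightarrow> recf_eval h [n] 0"
  proof
    assume "\<exists>s. subst s (query_fm (rec_program h) (zero_query n)) \<in> L"
    then have "zero_query n \<in> facts h"
      using unifiable_imp_in_closed[OF closed_rec_program safe_rec_program] assms(2)
      by (fastforce simp: zero_query_def)
    then show "recf_eval h [n] 0" by (simp add: zero_query_def)
  qed (simp add: derivable_unifiable derivable_zero_query_iff)
  finally show ?thesis .
qed

theorem theorem2:
  assumes "normal_logic_u L" and "Ku \<subseteq> L" and "L \<subseteq> K4u"
  shows "\<not> (\<exists>f. decides f rule_code (\<lambda>(phis, phi). admissible L phis phi))"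
proof
  assume "\<exists>f. decides f rule_code (\<lambda>(phis, phi). admissible L phis phi)"
  then obtain f where "decides f rule_code (\<lambda>(phis, phi). admissible L phis phi)" by blast
  then have f: "recf_eval f [rule_code x] (if admissible L (fst x) (snd x) then 0 else 1)" for x
    by (cases x) (simp add: decides_def)
  obtain r where r: "\<And>n. recf_eval r [n] (query_rule_code n)"
    using computable_query_rule_code by (auto simp: computable_def)
  define h where "h = Comp f [r]"
  \<comment> \<open>There is no circularity: \<open>rec_program h\<close> depends on
    \<open>h\<close> alone, and \<open>c\<close> enters only through the query.\<close>
  define c where "c = fm_code (prog_fm (rec_program h))"
  \<comment> \<open>The values are swapped because \<open>f\<close> answers 0 for an admissible
    rule, that is, when \<open>h\<close> does not return 0 at \<open>c\<close>.\<close>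
  have "recf_eval h [c] (if recf_eval h [c] 0 then 1 else 0)"
    using recf_eval_comp1[OF r[of c], of f]
      f[of "query_rule (rec_program h) c", unfolded admissible_query_rule_iff[OF assms(1,3)]]
    by (simp add: h_def[symmetric] c_def rule_code_query_rule split: if_splits)
  then show False
    using recf_eval_deterministic[of h "[c]" 0 1] by (auto split: if_splits)
qed

end
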